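(* Let $N \ge 2$ be an integer, let $p$ be a random variable uniformly distributed on $(0,1]$, and let $I_+ = \log_N \frac{p}{1/N} = 1 + \log_N p$. Then for every real $x$, $$\mathbf{P}[I_+ \le x] = \begin{cases} N^{x-1}, & x \in (-\infty, 1],\\ 1, & x > 1.\end{cases}$$ Consequently, for every $\alpha \in (0,1)$ and every real $x < 1$, $$\mathbf{P}[I_+ > x] < \alpha \iff x > 1 + \log_N(1-\alpha),$$ and $\mathbf{P}[I_+ > x] = 0$ whenever $x > 1$.
   Context: Here $I_+$ is the active information, measured with logarithm base $N$, of a given singleton in a finite space $\Omega = \{1,\dots,N\}$: the logarithm of the ratio of the probability $p$ of that singleton under an alternative distribution to its probability $1/N$ under the uniform distribution. The probability $p$ is itself treated as random. *)

theory Defs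
  imports "HOL-Probability.Probability"
begin

definition active_information :: "real \<Rightarrow> real \<Rightarrow> real \<Rightarrow> real" where
  "active_information b p p0 = log b (p / p0)"

(* Only the law of X is constrained, so X may leave S on a null set. *)
definition uniformly_distributed_on :: "'a measure \<Rightarrow> ('a \<Rightarrow> real) \<Rightarrow> real set \<Rightarrow> bool" where
  "uniformly_distributed_on M X S \<longleftrightarrow>
     X \<in> borel_measurable M \<and> distr M borel X = uniform_measure lborel S"

end

theory Submission
  imports Defs
begin

text \<open>
  With probability one \<open>p\<close> is positive, and on positive arguments \<open>t \<mapsto> 1 + log N t\<close> is
  an increasing bijection onto the reals with inverse \<open>x \<mapsto> N powr (x - 1)\<close>. Hence the events
  \<open>I \<le> x\<close> and \<open>p \<le> N powr (x - 1)\<close> agree up to a null set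
  (\<open>active_information_uniform_le_iff\<close>), and the distribution function of \<open>I\<close> is that
  of the uniform law, \<open>min t 1\<close> (\<open>uniformly_distributed_unit_cdf\<close>), at \<open>t = N powr (x - 1)\<close>;
  this point passes \<open>1\<close> exactly when \<open>x\<close> does. The tail statements are about the complementary
  event: for \<open>x < 1\<close> the inequality \<open>1 - N powr (x - 1) < \<alpha>\<close> is solved for \<open>x\<close> by
  taking logarithms.
\<close>

lemma uniformly_distributed_on_AE:
  assumes "uniformly_distributed_on M X S" and "S \<in> sets borel"
  shows "AE \<omega> in M. X \<omega> \<in> S"
proof -
  have X [measurable]: "X \<in> borel_measurable M"
    and law: "distr M borel X = uniform_measure lborel S"
    using assms(1) by (auto simp: uniformly_distributed_on_def)
  have "AE t in uniform_measure lborel S. t \<in> S"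
    using assms(2) by (intro AE_uniform_measureI) auto
  then have "AE t in distr M borel X. t \<in> S"
    by (simp only: law)
  then show ?thesis
    by (rule AE_distrD[OF X])
qed

lemma uniformly_distributed_unit_cdf:
  assumes "uniformly_distributed_on M X {0<..1}" and "0 \<le> t"
  shows "measure M {\<omega> \<in> space M. X \<omega> \<le> t} = min t 1"
proof -
  have X [measurable]: "X \<in> borel_measurable M"
    and law: "distr M borel X = uniform_measure lborel {0<..1}"
    using assms(1) by (auto simp: uniformly_distributed_on_def)
  have "measure M {\<omega> \<in> space M. X \<omega> \<le> t} = measure (distr M borel X) {..t}"
    by (subst measure_distr) (auto intro!: arg_cong[where f = "measure M"])
  also have "\<dots> = measure lborel ({0<..1} \<inter> {..t}) / measure lborel {0<..1::real}"
    unfolding law by (rule measure_uniform_measure) auto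
  also have "{0<..1} \<inter> {..t} = {0<..min t 1}"
    by auto
  finally show ?thesis
    using assms(2) by simp
qed

lemma active_information_uniform:
  assumes "1 < b" and "0 < t"
  shows "active_information b t (1 / b) = 1 + log b t"
  using assms by (simp add: active_information_def log_mult)

lemma active_information_uniform_le_iff:
  assumes "1 < b" and "0 < t"
  shows "active_information b t (1 / b) \<le> x \<longleftrightarrow> t \<le> b powr (x - 1)"
proof -
  have "active_information b t (1 / b) \<le> x \<longleftrightarrow> log b t \<le> x - 1"
    using active_information_uniform[OF assms] by auto
  then show ?thesis
    using assms by (simp add: log_le_iff)
qed

theorem mainTheorem1:
  fixes N :: nat and M :: "'a measure" and p I :: "'a \<Rightarrow> real"
  assumes "N \<ge> 2"
    and "prob_space M"
    and "uniformly_distributed_on M p {0<..1}"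
    and "\<And>\<omega>. \<omega> \<in> space M \<Longrightarrow> I \<omega> = active_information (real N) (p \<omega>) (1 / real N)"
  shows "(AE \<omega> in M. I \<omega> = 1 + log (real N) (p \<omega>)) \<and>
    (\<forall>x::real. measure M {\<omega> \<in> space M. I \<omega> \<le> x} = (if x \<le> 1 then real N powr (x - 1) else 1)) \<and>
    (\<forall>\<alpha>\<in>{0<..<1::real}. \<forall>x<1.
       measure M {\<omega> \<in> space M. I \<omega> > x} < \<alpha> \<longleftrightarrow> x > 1 + log (real N) (1 - \<alpha>)) \<and>
    (\<forall>x>1. measure M {\<omega> \<in> space M. I \<omega> > x} = 0)"
proof -
  interpret prob_space M by fact
  have N: "1 < real N"
    using assms(1) by simp
  have p [measurable]: "p \<in> borel_measurable M"
    using assms(3) by (simp add: uniformly_distributed_on_def)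
  have "(\<lambda>\<omega>. active_information (real N) (p \<omega>) (1 / real N)) \<in> borel_measurable M"
    unfolding active_information_def by measurable
  then have I [measurable]: "I \<in> borel_measurable M"
    using assms(4) by (simp cong: measurable_cong)
  have pos: "AE \<omega> in M. 0 < p \<omega>"
    using uniformly_distributed_on_AE[OF assms(3)] by simp

  have formula: "AE \<omega> in M. I \<omega> = 1 + log (real N) (p \<omega>)"
    using pos AE_space by eventually_elim (simp add: assms(4) active_information_uniform[OF N])

  have cdf: "prob {\<omega> \<in> space M. I \<omega> \<le> x} = (if x \<le> 1 then real N powr (x - 1) else 1)" for x
  proof -
    have "AE \<omega> in M. I \<omega> \<le> x \<longleftrightarrow> p \<omega> \<le> real N powr (x - 1)"
      using pos AE_space
      by eventually_elim (simp add: assms(4) active_information_uniform_le_iff[OF N])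
    then have "prob {\<omega> \<in> space M. I \<omega> \<le> x} = prob {\<omega> \<in> space M. p \<omega> \<le> real N powr (x - 1)}"
      by (intro measure_eq_AE) auto
    also have "\<dots> = min (real N powr (x - 1)) 1"
      using assms(3) by (rule uniformly_distributed_unit_cdf) simp
    also have "\<dots> = (if x \<le> 1 then real N powr (x - 1) else 1)"
      using powr_le_cancel_iff[OF N, of "x - 1" 0] N by (auto simp: min_def)
    finally show ?thesis .
  qed

  have tail: "prob {\<omega> \<in> space M. I \<omega> > x} = 1 - prob {\<omega> \<in> space M. I \<omega> \<le> x}" for x
  proof -
    have "{\<omega> \<in> space M. I \<omega> > x} = space M - {\<omega> \<in> space M. I \<omega> \<le> x}"
      by auto
    then show ?thesis
      by (simp add: prob_compl)
  qed

  have threshold: "prob {\<omega> \<in> space M. I \<omega> > x} < \<alpha> \<longleftrightarrow> x > 1 + log (real N) (1 - \<alpha>)"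
    if "\<alpha> \<in> {0<..<1}" and "x < 1" for \<alpha> x
  proof -
    have "prob {\<omega> \<in> space M. I \<omega> > x} < \<alpha> \<longleftrightarrow> 1 - \<alpha> < real N powr (x - 1)"
      using that by (auto simp: tail cdf)
    also have "\<dots> \<longleftrightarrow> log (real N) (1 - \<alpha>) < x - 1"
      using that N by (simp add: log_less_iff)
    finally show ?thesis
      by auto
  qed

  show ?thesis
    using formula cdf threshold by (auto simp: tail)
qed

end
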